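(* There exists a matrix $A\in S(10,3)$ with $\det(A)=15$ such that all off-diagonal entries of $AA^T$ and of $A^TA$ lie in $\{0,1\}$, whereas $M(10,3)\ge48$. Consequently the following conjecture of Li, Lin and Rodman is false: "if $\lambda=k(k-1)/(n-1)$ and $A\in S(n,k)$ is non-singular and every off-diagonal entry $x$ of $AA^T$ and of $A^TA$ satisfies $|x-\lambda|<1$, then $|\det(A)|=M(n,k)$" (it fails for $n=10$, $k=3$, $\lambda=2/3$).
   Context: $S(n,k)$ denotes the set of $n\times n$ matrices with entries in $\{0,1\}$ all of whose rows and columns sum to $k$. $M(n,k)=\max_{A\in S(n,k)}\det(A)$. *)

theory Defs
  imports Complex_Main "Jordan_Normal_Form.Determinant"
begin

(* The set S(n,k).  The matrices are taken over the reals, so that "non-singular" is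
   invertibility over a field and entries can be compared with the rational number lambda. *)
definition S :: "nat \<Rightarrow> nat \<Rightarrow> real mat set" where
  "S n k = {A \<in> carrier_mat n n.
     (\<forall>i<n. \<forall>j<n. A $$ (i, j) \<in> {0, 1}) \<and>
     (\<forall>i<n. (\<Sum>j<n. A $$ (i, j)) = real k) \<and>
     (\<forall>j<n. (\<Sum>i<n. A $$ (i, j)) = real k)}"

(* S(n,k) is always finite.  It is empty when 0 < n < k, and then M n k is an unspecified value. *)
definition M :: "nat \<Rightarrow> nat \<Rightarrow> real" where
  "M n k = Max (det ` S n k)"

definition lam :: "nat \<Rightarrow> nat \<Rightarrow> real" where
  "lam n k = real k * (real k - 1) / (real n - 1)"

definition offdiag_entries :: "real mat \<Rightarrow> real set" where
  "offdiag_entries B = {B $$ (i, j) | i j. i < dim_row B \<and> j < dim_col B \<and> i \<noteq> j}"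

(* The conjecture of Li, Lin and Rodman for one pair (n,k). *)
definition LLR_conjecture_for :: "nat \<Rightarrow> nat \<Rightarrow> bool" where
  "LLR_conjecture_for n k \<longleftrightarrow>
     (\<forall>A \<in> S n k.
        invertible_mat A \<longrightarrow>
        (\<forall>x \<in> offdiag_entries (A * transpose_mat A) \<union> offdiag_entries (transpose_mat A * A).
           \<bar>x - lam n k\<bar> < 1) \<longrightarrow>
        \<bar>det A\<bar> = M n k)"

(* n \<ge> 2 is exactly what makes the denominator n - 1 of lambda positive. *)
definition LLR_conjecture :: bool where
  "LLR_conjecture \<longleftrightarrow> (\<forall>n k. n \<ge> 2 \<longrightarrow> LLR_conjecture_for n k)"

end

theory Submission
  imports Defs
begin

text \<open>
  Two explicit matrices do everything.  Both are incidence matrices of configurations of ten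
  points and ten lines: each line has three points, each point lies on three lines, and two lines
  meet in at most one point.  Hence both lie in \<open>S 10 3\<close>, and every off-diagonal entry of either
  Gram matrix counts the common points of two lines or the common lines of two points, so it is
  0 or 1.  Since \<open>\<lambda> = 2/3\<close>, those are exactly the integers at distance less than 1 from \<open>\<lambda>\<close>: the
  hypothesis of the conjecture only says that the matrix comes from such a configuration, and
  configurations with the same parameters can have different determinants.

  The matrices below have determinants 15 and 48.  Each determinant is certified by an integral
  factorisation into a lower unitriangular and an upper triangular matrix.  For 48 there
  is also a structural reason.  Let \<open>P\<close> be the cyclic shift of order 5 and \<open>J\<close> the all-ones matrix
  of order 5.  Up to the order of its rows, the second matrix consists of the circulant blocks
  \<open>I, P + P^3\<close> (above) and \<open>I + P, I\<close> (below), so its determinant is, up to sign, that of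
  \<open>I - (I + P)(P + P^3) = 2I - J\<close>, whose eigenvalues are -3 (once) and 2 (four times).

  Finiteness of \<open>S 10 3\<close> turns the second matrix into the bound \<open>M 10 3 \<ge> 48\<close>; the first matrix
  then violates the conclusion of the conjecture because 15 is less than 48.
\<close>

section \<open>Finiteness of the set of matrices\<close>

text \<open>
  Finiteness is what makes the maximum defining \<open>M\<close> an upper bound: a matrix with entries in
  \<open>{0, 1}\<close> is determined by the set of positions of its ones.
\<close>

lemma finite_S: "finite (S n k)"
proof (rule finite_subset)
  let ?f = "\<lambda>T. mat n n (\<lambda>p. if p \<in> T then 1 else (0::real))"
  show "S n k \<subseteq> ?f ` Pow ({..<n} \<times> {..<n})"
  proof
    fix A assume "A \<in> S n k"
    then have A: "A \<in> carrier_mat n n" and e: "\<forall>i<n. \<forall>j<n. A $$ (i, j) \<in> {0, 1}"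
      by (auto simp: S_def)
    have "A = ?f {p \<in> {..<n} \<times> {..<n}. A $$ p = 1}"
      using A e by (intro eq_matI) auto
    then show "A \<in> ?f ` Pow ({..<n} \<times> {..<n})" by blast
  qed
qed simp

lemma det_le_M: "A \<in> S n k \<Longrightarrow> det A \<le> M n k"
  unfolding M_def by (intro Max_ge finite_imageI finite_S imageI)

lemma invertible_mat_if_det_nonzero:
  fixes A :: "real mat"
  assumes A: "A \<in> carrier_mat n n" and "det A \<noteq> 0"
  shows "invertible_mat A"
proof -
  obtain B where B: "B \<in> carrier_mat n n" "B * A = 1\<^sub>m n" "A * B = 1\<^sub>m n"
    using det_non_zero_imp_unit[OF assms, of "()"]
    by (auto simp: Units_def ring_mat_def)
  show ?thesis
    unfolding invertible_mat_def inverts_mat_def using A B by auto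
qed

section \<open>Determinants and Gram matrices of matrices given by rows\<close>

lemma det_LU:
  fixes A :: "real mat"
  assumes A: "A = L * U" and L: "L \<in> carrier_mat n n" and U: "U \<in> carrier_mat n n"
    and l: "\<forall>i<n. \<forall>j<n. i < j \<longrightarrow> L $$ (i, j) = 0" and l1: "\<forall>i<n. L $$ (i, i) = 1"
    and u: "\<forall>i<n. \<forall>j<n. j < i \<longrightarrow> U $$ (i, j) = 0"
  shows "det A = (\<Prod>i<n. U $$ (i, i))"
proof -
  have "det L = 1"
    using L l l1 by (subst det_lower_triangular[OF _ L]) (auto simp: prod_list_diag_prod)
  moreover have "det U = (\<Prod>i<n. U $$ (i, i))"
    using U u by (subst det_upper_triangular[OF _ U])
      (auto simp: prod_list_diag_prod upper_triangular_def lessThan_atLeast0)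
  ultimately show ?thesis
    using A det_mult[OF L U] by simp
qed

abbreviation mat10 :: "real list list \<Rightarrow> real mat" where
  "mat10 rs \<equiv> mat 10 10 (\<lambda>(i, j). rs ! i ! j)"

text \<open>
  The range of the indices is made explicit, so that each property of a concrete matrix
  becomes a finite conjunction of numerical identities.
\<close>

lemma all_less_10:
  "(\<forall>i<10. P i) \<longleftrightarrow> P 0 \<and> P 1 \<and> P 2 \<and> P 3 \<and> P 4 \<and> P 5 \<and> P 6 \<and> P 7 \<and> P 8 \<and> P (9::nat)"
  by (simp add: numeral_eq_Suc All_less_Suc) blast

lemma lessThan_10: "{..<10::nat} = {0, 1, 2, 3, 4, 5, 6, 7, 8, 9}"
  by auto

lemma mat10_eq_mult:
  assumes "\<forall>i<10. \<forall>j<10. rs ! i ! j = (\<Sum>k<10. ls ! i ! k * us ! k ! j)"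
  shows "mat10 rs = mat10 ls * mat10 us"
  using assms by (intro eq_matI) (auto simp: scalar_prod_def lessThan_atLeast0)

lemma offdiag_mat10_transpose:
  assumes "\<forall>i<10. \<forall>j<10. i \<noteq> j \<longrightarrow> (\<Sum>k<10. rs ! i ! k * rs ! j ! k) \<in> X"
  shows "offdiag_entries (mat10 rs * transpose_mat (mat10 rs)) \<subseteq> X"
  using assms by (auto simp: offdiag_entries_def scalar_prod_def lessThan_atLeast0)

lemma offdiag_transpose_mat10:
  assumes "\<forall>i<10. \<forall>j<10. i \<noteq> j \<longrightarrow> (\<Sum>k<10. rs ! k ! i * rs ! k ! j) \<in> X"
  shows "offdiag_entries (transpose_mat (mat10 rs) * mat10 rs) \<subseteq> X"
  using assms by (auto simp: offdiag_entries_def scalar_prod_def lessThan_atLeast0)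

section \<open>A configuration with determinant 15\<close>

definition rows15 :: "real list list" where
  "rows15 =
    [[1, 0, 0, 0, 0, 0, 1, 0, 0, 1],
     [0, 1, 0, 0, 0, 1, 1, 0, 0, 0],
     [0, 0, 1, 0, 0, 0, 0, 1, 1, 0],
     [0, 0, 0, 1, 0, 1, 0, 0, 1, 0],
     [0, 0, 0, 0, 1, 0, 0, 0, 1, 1],
     [0, 0, 0, 0, 0, 1, 0, 1, 0, 1],
     [0, 0, 1, 1, 0, 0, 1, 0, 0, 0],
     [1, 0, 0, 1, 1, 0, 0, 0, 0, 0],
     [0, 1, 0, 0, 1, 0, 0, 1, 0, 0],
     [1, 1, 1, 0, 0, 0, 0, 0, 0, 0]]"

definition lower15 :: "real list list" where
  "lower15 =
    [[1, 0, 0, 0, 0, 0, 0, 0, 0, 0],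
     [0, 1, 0, 0, 0, 0, 0, 0, 0, 0],
     [0, 0, 1, 0, 0, 0, 0, 0, 0, 0],
     [0, 0, 0, 1, 0, 0, 0, 0, 0, 0],
     [0, 0, 0, 0, 1, 0, 0, 0, 0, 0],
     [0, 0, 0, 0, 0, 1, 0, 0, 0, 0],
     [0, 0, 1, 1, 0, -1, 1, 0, 0, 0],
     [1, 0, 0, 1, 1, -1, -1, 1, 0, 0],
     [0, 1, 0, 0, 1, -1, -1, 2, 1, 0],
     [1, 1, 1, 0, 0, -1, -2, 0, -1, 1]]"

definition upper15 :: "real list list" where
  "upper15 =
    [[1, 0, 0, 0, 0, 0, 1, 0, 0, 1],
     [0, 1, 0, 0, 0, 1, 1, 0, 0, 0],
     [0, 0, 1, 0, 0, 0, 0, 1, 1, 0],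
     [0, 0, 0, 1, 0, 1, 0, 0, 1, 0],
     [0, 0, 0, 0, 1, 0, 0, 0, 1, 1],
     [0, 0, 0, 0, 0, 1, 0, 1, 0, 1],
     [0, 0, 0, 0, 0, 0, 1, 0, -2, 1],
     [0, 0, 0, 0, 0, 0, 0, 1, -4, 0],
     [0, 0, 0, 0, 0, 0, 0, 0, 5, 1],
     [0, 0, 0, 0, 0, 0, 0, 0, 0, 3]]"

lemma rows15_in_S: "mat10 rows15 \<in> S 10 3"
  unfolding S_def lessThan_10 rows15_def by (simp add: all_less_10)

lemma det_rows15: "det (mat10 rows15) = 15"
proof -
  have "mat10 rows15 = mat10 lower15 * mat10 upper15"
    by (rule mat10_eq_mult) (simp add: all_less_10 lessThan_10 rows15_def lower15_def upper15_def)
  then have "det (mat10 rows15) = (\<Prod>i<10. mat10 upper15 $$ (i, i))"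
    by (rule det_LU) (simp_all add: all_less_10 lower15_def upper15_def)
  also have "\<dots> = 15"
    by (simp add: lessThan_10 upper15_def)
  finally show ?thesis .
qed

lemma offdiag_rows15:
  shows "offdiag_entries (mat10 rows15 * transpose_mat (mat10 rows15)) \<subseteq> {0, 1}"
    and "offdiag_entries (transpose_mat (mat10 rows15) * mat10 rows15) \<subseteq> {0, 1}"
  by (rule offdiag_mat10_transpose offdiag_transpose_mat10,
      simp add: all_less_10 lessThan_10 rows15_def)+

section \<open>A configuration with determinant 48\<close>

text \<open>
  The last five rows are those of the block row \<open>I + P, I\<close> with indices 2, 0, 1, 4, 3.  This is an
  odd permutation, which makes the determinant positive, and the order is one for which elimination
  in \<open>2I - J\<close> stays integral.
\<close>

definition rows48 :: "real list list" where
  "rows48 =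
    [[1, 0, 0, 0, 0, 0, 1, 0, 1, 0],
     [0, 1, 0, 0, 0, 0, 0, 1, 0, 1],
     [0, 0, 1, 0, 0, 1, 0, 0, 1, 0],
     [0, 0, 0, 1, 0, 0, 1, 0, 0, 1],
     [0, 0, 0, 0, 1, 1, 0, 1, 0, 0],
     [0, 0, 1, 1, 0, 0, 0, 1, 0, 0],
     [1, 1, 0, 0, 0, 1, 0, 0, 0, 0],
     [0, 1, 1, 0, 0, 0, 1, 0, 0, 0],
     [1, 0, 0, 0, 1, 0, 0, 0, 0, 1],
     [0, 0, 0, 1, 1, 0, 0, 0, 1, 0]]"

definition lower48 :: "real list list" where
  "lower48 =
    [[1, 0, 0, 0, 0, 0, 0, 0, 0, 0],
     [0, 1, 0, 0, 0, 0, 0, 0, 0, 0],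
     [0, 0, 1, 0, 0, 0, 0, 0, 0, 0],
     [0, 0, 0, 1, 0, 0, 0, 0, 0, 0],
     [0, 0, 0, 0, 1, 0, 0, 0, 0, 0],
     [0, 0, 1, 1, 0, 1, 0, 0, 0, 0],
     [1, 1, 0, 0, 0, -1, 1, 0, 0, 0],
     [0, 1, 1, 0, 0, 1, -1, 1, 0, 0],
     [1, 0, 0, 0, 1, 1, 0, 1, 1, 0],
     [0, 0, 0, 1, 1, 1, 0, 1, 2, 1]]"

text \<open>The lower right block is \<open>2I - J\<close>, with its rows in the order above, after elimination.\<close>

definition upper48 :: "real list list" where
  "upper48 =
    [[1, 0, 0, 0, 0, 0, 1, 0, 1, 0],
     [0, 1, 0, 0, 0, 0, 0, 1, 0, 1],
     [0, 0, 1, 0, 0, 1, 0, 0, 1, 0],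
     [0, 0, 0, 1, 0, 0, 1, 0, 0, 1],
     [0, 0, 0, 0, 1, 1, 0, 1, 0, 0],
     [0, 0, 0, 0, 0, -1, -1, 1, -1, -1],
     [0, 0, 0, 0, 0, 0, -2, 0, -2, -2],
     [0, 0, 0, 0, 0, 0, 0, -2, -2, -2],
     [0, 0, 0, 0, 0, 0, 0, 0, 2, 4],
     [0, 0, 0, 0, 0, 0, 0, 0, 0, -6]]"

lemma rows48_in_S: "mat10 rows48 \<in> S 10 3"
  unfolding S_def lessThan_10 rows48_def by (simp add: all_less_10)

lemma det_rows48: "det (mat10 rows48) = 48"
proof -
  have "mat10 rows48 = mat10 lower48 * mat10 upper48"
    by (rule mat10_eq_mult) (simp add: all_less_10 lessThan_10 rows48_def lower48_def upper48_def)
  then have "det (mat10 rows48) = (\<Prod>i<10. mat10 upper48 $$ (i, i))"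
    by (rule det_LU) (simp_all add: all_less_10 lower48_def upper48_def)
  also have "\<dots> = 48"
    by (simp add: lessThan_10 upper48_def)
  finally show ?thesis .
qed

section \<open>Failure of the conjecture\<close>

theorem mainTheorem8:
  shows "(\<exists>A \<in> S 10 3. det A = 15 \<and>
            offdiag_entries (A * transpose_mat A) \<subseteq> {0, 1} \<and>
            offdiag_entries (transpose_mat A * A) \<subseteq> {0, 1})
       \<and> M 10 3 \<ge> 48
       \<and> lam 10 3 = 2 / 3
       \<and> \<not> LLR_conjecture_for 10 3
       \<and> \<not> LLR_conjecture"
proof -
  let ?A = "mat10 rows15"
  have M: "M 10 3 \<ge> 48"
    using det_le_M[OF rows48_in_S] by (simp add: det_rows48)
  have lam: "lam 10 3 = 2 / 3"
    by (simp add: lam_def)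
  have "invertible_mat ?A"
    by (rule invertible_mat_if_det_nonzero[where n = 10]) (simp_all add: det_rows15)
  moreover have "\<bar>x - lam 10 3\<bar> < 1"
    if "x \<in> offdiag_entries (?A * transpose_mat ?A) \<union> offdiag_entries (transpose_mat ?A * ?A)" for x
  proof -
    have "x \<in> {0, 1}" using that offdiag_rows15 by blast
    then show ?thesis by (auto simp: lam)
  qed
  moreover have "\<bar>det ?A\<bar> \<noteq> M 10 3"
    using M by (simp add: det_rows15)
  ultimately have for_10_3: "\<not> LLR_conjecture_for 10 3"
    unfolding LLR_conjecture_for_def using rows15_in_S by blast
  have "LLR_conjecture_for 10 3" if LLR_conjecture
    using that by (simp add: LLR_conjecture_def)
  with for_10_3 have "\<not> LLR_conjecture" by blast
  then show ?thesis
    using rows15_in_S det_rows15 offdiag_rows15 M lam for_10_3 by blast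
qed

end
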